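(* Let $h:\mathbb{R}^m\to\bar{\mathbb{R}}$ be lower semicontinuous, let $c:\mathbb{R}^n\to\mathbb{R}^m$ be continuously differentiable, and let $\bar x\in\mathbb{R}^n$ be a critical point of $h\circ c$ satisfying $\partial^\infty h(c(\bar x))\cap N(\nabla c(\bar x)^* )=\{0\}$. Let $\mathcal{G}$ be any finite family of closed subsets of $\mathrm{gph}(\partial h)$. Then for any sequences of points $x_r\in\mathbb{R}^n$, vectors $c_r\in\mathbb{R}^m$, subgradients $v_r\in\partial h(c_r)$, and sets $G_r\in\mathcal{G}$ ($r=1,2,\ldots$) satisfying, as $r\to\infty$, $$x_r\to\bar x,\quad |c_r-c(x_r)|\to0,\quad h(c_r)\to h(c(\bar x)),\quad \nabla c(x_r)^*v_r\to0,\quad \mathrm{dist}\big((c_r,v_r),G_r\big)\to0,$$ the set $G_r$ is actively sufficient for $\bar x$ for all $r$ sufficiently large.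
   Context: $\bar{\mathbb{R}}=[-\infty,+\infty]$; $|\cdot|$ is the Euclidean norm and $\mathrm{dist}$ the Euclidean distance to a set ($+\infty$ for the empty set). Subdifferentials are as in Rockafellar–Wets, Variational Analysis: at a point $\bar c$ where $h$ is finite, $v$ is a regular subgradient if $h(c)\ge h(\bar c)+\langle v,c-\bar c\rangle+o(|c-\bar c|)$; $v\in\partial h(\bar c)$ if there are $c_r\to\bar c$ with $h(c_r)\to h(\bar c)$ and regular subgradients $v_r$ of $h$ at $c_r$ with $v_r\to v$; $v\in\partial^\infty h(\bar c)$ (horizon subdifferential) if there are such $c_r$, regular subgradients $v_r$ at $c_r$, and scalars $\lambda_r\downarrow0$ with $\lambda_r v_r\to v$. Where $h$ is not finite, $\partial h=\emptyset$. $\mathrm{gph}(\partial h)=\{(c,v):v\in\partial h(c)\}$. $\nabla c(x)^*$ is the adjoint of the derivative $\nabla c(x):\mathbb{R}^n\to\mathbb{R}^m$, and $N(\cdot)$ denotes null space. A point $\bar x$ is critical for $h\circ c$ if $0\in\partial(h\circ c)(\bar x)$. A multiplier vector for a critical point $\bar x$ is $v\in\mathbb{R}^m$ with $v\in\partial h(c(\bar x))$ and $\nabla c(\bar x)^*v=0$. An actively sufficient set for $\bar x$ is a set $G\subset\mathrm{gph}(\partial h)$ containing a point $(c(\bar x),\bar v)$ where $\bar v$ is a multiplier vector for $\bar x$. *)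

theory Defs
  imports "HOL-Analysis.Analysis" "HOL-Library.Landau_Symbols"
begin

definition lower_semicontinuous :: "('a::topological_space \<Rightarrow> ereal) \<Rightarrow> bool" where
  "lower_semicontinuous h \<longleftrightarrow> (\<forall>x. h x \<le> Liminf (nhds x) h)"

definition continuously_differentiable ::
    "('a::real_normed_vector \<Rightarrow> 'b::real_normed_vector) \<Rightarrow> bool" where
  "continuously_differentiable c \<longleftrightarrow>
     (\<exists>c' :: 'a \<Rightarrow> 'a \<Rightarrow>\<^sub>L 'b.
        (\<forall>x. (c has_derivative blinfun_apply (c' x)) (at x)) \<and> continuous_on UNIV c')"

definition grad_adjoint ::
    "('a::euclidean_space \<Rightarrow> 'b::euclidean_space) \<Rightarrow> 'a \<Rightarrow> 'b \<Rightarrow> 'a" where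
  "grad_adjoint c x = adjoint (frechet_derivative c (at x))"

text \<open>The inequality is only required near \<open>x\<close>, the error term being a local notion.\<close>

definition regular_subdifferential ::
    "('a::euclidean_space \<Rightarrow> ereal) \<Rightarrow> 'a \<Rightarrow> 'a set" where
  "regular_subdifferential h x =
     {v. \<bar>h x\<bar> \<noteq> \<infinity> \<and>
         (\<exists>\<rho> :: 'a \<Rightarrow> real. \<rho> \<in> o[at x](\<lambda>y. norm (y - x)) \<and>
            (\<forall>\<^sub>F y in at x. h y \<ge> h x + ereal (v \<bullet> (y - x) + \<rho> y)))}"

definition subdifferential ::
    "('a::euclidean_space \<Rightarrow> ereal) \<Rightarrow> 'a \<Rightarrow> 'a set" where
  "subdifferential h x =
     {v. \<bar>h x\<bar> \<noteq> \<infinity> \<and>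
         (\<exists>(y :: nat \<Rightarrow> 'a) (w :: nat \<Rightarrow> 'a).
            y \<longlonglongrightarrow> x \<and> (\<lambda>r. h (y r)) \<longlonglongrightarrow> h x \<and>
            (\<forall>r. w r \<in> regular_subdifferential h (y r)) \<and> w \<longlonglongrightarrow> v)}"

definition horizon_subdifferential ::
    "('a::euclidean_space \<Rightarrow> ereal) \<Rightarrow> 'a \<Rightarrow> 'a set" where
  "horizon_subdifferential h x =
     {v. \<bar>h x\<bar> \<noteq> \<infinity> \<and>
         (\<exists>(y :: nat \<Rightarrow> 'a) (w :: nat \<Rightarrow> 'a) (t :: nat \<Rightarrow> real).
            y \<longlonglongrightarrow> x \<and> (\<lambda>r. h (y r)) \<longlonglongrightarrow> h x \<and>
            (\<forall>r. w r \<in> regular_subdifferential h (y r)) \<and>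
            (\<forall>r. t r > 0) \<and> t \<longlonglongrightarrow> 0 \<and> (\<lambda>r. t r *\<^sub>R w r) \<longlonglongrightarrow> v)}"

definition gph_subdifferential ::
    "('a::euclidean_space \<Rightarrow> ereal) \<Rightarrow> ('a \<times> 'a) set" where
  "gph_subdifferential h = {(x, v). v \<in> subdifferential h x}"

definition critical_point :: "('a::euclidean_space \<Rightarrow> ereal) \<Rightarrow> 'a \<Rightarrow> bool" where
  "critical_point f x \<longleftrightarrow> 0 \<in> subdifferential f x"

definition multiplier_vector ::
    "('b::euclidean_space \<Rightarrow> ereal) \<Rightarrow> ('a::euclidean_space \<Rightarrow> 'b) \<Rightarrow> 'a \<Rightarrow> 'b \<Rightarrow> bool" where
  "multiplier_vector h c x v \<longleftrightarrow>
     v \<in> subdifferential h (c x) \<and> grad_adjoint c x v = 0"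

definition actively_sufficient ::
    "('b::euclidean_space \<Rightarrow> ereal) \<Rightarrow> ('a::euclidean_space \<Rightarrow> 'b) \<Rightarrow> 'a \<Rightarrow> ('b \<times> 'b) set \<Rightarrow> bool" where
  "actively_sufficient h c x G \<longleftrightarrow>
     G \<subseteq> gph_subdifferential h \<and> (\<exists>v. multiplier_vector h c x v \<and> (c x, v) \<in> G)"

text \<open>
  Extended-valued, so that the distance to the empty set is \<open>\<infinity>\<close>; the library's
  \<^const>\<open>infdist\<close> is \<open>0\<close> there. On \<open>'b \<times> 'b\<close>, \<^const>\<open>dist\<close> is the Euclidean distance.
\<close>

definition dist_to_set :: "'a::metric_space \<Rightarrow> 'a set \<Rightarrow> ereal" where
  "dist_to_set x A = (INF a\<in>A. ereal (dist x a))"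

end

theory Submission
  imports Defs
begin

text \<open>
  The weights \<open>t\<^sub>r = 1 / (1 + |v\<^sub>r|)\<close> compactify the multiplier sequence: along a subsequence
  \<open>t\<^sub>r\<close> and \<open>t\<^sub>r v\<^sub>r\<close> converge, say to \<open>\<tau>\<close> and \<open>w\<close>. If \<open>\<tau> = 0\<close>, then \<open>|w| = 1\<close> and \<open>w\<close> is a
  horizon subgradient annihilated by \<open>\<nabla>c(x)\<^sup>*\<close>, against the constraint qualification. So
  \<open>\<tau> > 0\<close>, and \<open>v\<^sub>r\<close> converges to \<open>w / \<tau>\<close>, a multiplier vector by \<open>h\<close>-attentive closedness of
  the subdifferential. As the family is finite, if the conclusion failed then one insufficient set
  would occur infinitely often; being closed, it would contain the limit pair.
\<close>

text \<open>One tolerance \<open>e\<close> controls point, value and subgradient together. Values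
  are compared as reals, which loses nothing: \<open>h\<close> is finite at \<open>y\<close>, and at
  \<open>z\<close> because a regular subgradient exists there.\<close>

lemma regular_subgradient_approx:
  fixes h :: "'a::euclidean_space \<Rightarrow> ereal"
  assumes "v \<in> subdifferential h y" and "e > 0"
  obtains z w where "w \<in> regular_subdifferential h z" "dist z y < e"
    "dist (real_of_ereal (h z)) (real_of_ereal (h y)) < e" "dist w v < e"
proof -
  from assms(1) obtain z w where fin: "\<bar>h y\<bar> \<noteq> \<infinity>" and zw: "z \<longlonglongrightarrow> y" "(\<lambda>r. h (z r)) \<longlonglongrightarrow> h y"
    "\<And>r. w r \<in> regular_subdifferential h (z r)" "w \<longlonglongrightarrow> v"
    by (auto simp: subdifferential_def)
  have "(\<lambda>r. real_of_ereal (h (z r))) \<longlonglongrightarrow> real_of_ereal (h y)"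
    using zw(2) fin by (metis ereal_real' lim_real_of_ereal)
  from tendstoD[OF zw(1) assms(2)] tendstoD[OF this assms(2)] tendstoD[OF zw(4) assms(2)]
  have "\<forall>\<^sub>F r in sequentially. dist (z r) y < e \<and>
      dist (real_of_ereal (h (z r))) (real_of_ereal (h y)) < e \<and> dist (w r) v < e"
    by (intro eventually_conj)
  then obtain r where "dist (z r) y < e"
      "dist (real_of_ereal (h (z r))) (real_of_ereal (h y)) < e" "dist (w r) v < e"
    using eventually_happens by force
  with zw(3) that show thesis by blast
qed

lemma tendsto_dist_trans:
  fixes a b :: "nat \<Rightarrow> 'a::metric_space"
  assumes "\<And>r. dist (a r) (b r) < e r" "e \<longlonglongrightarrow> (0::real)" "b \<longlonglongrightarrow> l"
  shows "a \<longlonglongrightarrow> l"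
proof -
  have "(\<lambda>r. e r + dist (b r) l) \<longlonglongrightarrow> 0"
    using tendsto_add[OF assms(2) iffD1[OF tendsto_dist_iff assms(3)]] by simp
  moreover have "dist (a r) l \<le> e r + dist (b r) l" for r
    using assms(1)[of r] dist_triangle[of "a r" l "b r"] by linarith
  ultimately show ?thesis
    by (subst tendsto_dist_iff) (rule tendsto_sandwich[OF _ _ tendsto_const], auto)
qed

text \<open>A diagonal choice: at each index, one regular subgradient is taken within
  \<open>1/(r+1)\<close> of the given point, value and subgradient. Only \<open>w r - v r\<close> is
  claimed to converge, so \<open>v\<close> may be unbounded; this lets the lemma serve both the
  subdifferential and its horizon version.\<close>

lemma regular_subgradient_diagonal:
  fixes h :: "'a::euclidean_space \<Rightarrow> ereal"
  assumes sub: "\<And>r. v r \<in> subdifferential h (y r)" and y: "y \<longlonglongrightarrow> p"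
    and hy: "(\<lambda>r. h (y r)) \<longlonglongrightarrow> h p" and fin: "\<bar>h p\<bar> \<noteq> \<infinity>"
  obtains z w where "z \<longlonglongrightarrow> p" "(\<lambda>r. h (z r)) \<longlonglongrightarrow> h p"
    "\<And>r. w r \<in> regular_subdifferential h (z r)" "(\<lambda>r. w r - v r) \<longlonglongrightarrow> 0"
proof -
  define e :: "nat \<Rightarrow> real" where "e r = inverse (real (Suc r))" for r
  have e0: "e \<longlonglongrightarrow> 0"
    unfolding e_def by (rule LIMSEQ_inverse_real_of_nat)
  have "\<exists>z w. w \<in> regular_subdifferential h z \<and> dist z (y r) < e r \<and>
      dist (real_of_ereal (h z)) (real_of_ereal (h (y r))) < e r \<and> dist w (v r) < e r" for r
    by (rule regular_subgradient_approx[OF sub, of "e r"]) (auto simp: e_def)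
  then obtain z w where zw: "\<And>r. w r \<in> regular_subdifferential h (z r)"
    "\<And>r. dist (z r) (y r) < e r"
    "\<And>r. dist (real_of_ereal (h (z r))) (real_of_ereal (h (y r))) < e r"
    "\<And>r. dist (w r) (v r) < e r"
    by metis
  have z: "z \<longlonglongrightarrow> p"
    by (rule tendsto_dist_trans[OF zw(2) e0 y])
  have "(\<lambda>r. real_of_ereal (h (y r))) \<longlonglongrightarrow> real_of_ereal (h p)"
    using hy fin by (metis ereal_real' lim_real_of_ereal)
  then have "(\<lambda>r. real_of_ereal (h (z r))) \<longlonglongrightarrow> real_of_ereal (h p)"
    by (rule tendsto_dist_trans[OF zw(3) e0])
  then have "(\<lambda>r. ereal (real_of_ereal (h (z r)))) \<longlonglongrightarrow> ereal (real_of_ereal (h p))"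
    by (rule tendsto_ereal)
  \<comment> \<open>Regular subgradients exist only at points of finite value, so the real limit
    lifts back to an extended-valued one.\<close>
  moreover have "ereal (real_of_ereal (h (z r))) = h (z r)" for r
    using zw(1)[of r] by (auto simp: regular_subdifferential_def ereal_real)
  ultimately have hz: "(\<lambda>r. h (z r)) \<longlonglongrightarrow> h p"
    using fin by (simp add: ereal_real)
  have "(\<lambda>r. w r - v r) \<longlonglongrightarrow> 0"
    by (rule tendsto_dist_trans[where b = "\<lambda>_. 0", OF _ e0]) (use zw(4) in \<open>auto simp: dist_norm\<close>)
  with z hz zw(1) that show thesis by blast
qed

lemma subdifferential_closed:
  fixes h :: "'a::euclidean_space \<Rightarrow> ereal"
  assumes "\<And>r. v r \<in> subdifferential h (y r)" "y \<longlonglongrightarrow> p"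
    "(\<lambda>r. h (y r)) \<longlonglongrightarrow> h p" "\<bar>h p\<bar> \<noteq> \<infinity>" "v \<longlonglongrightarrow> u"
  shows "u \<in> subdifferential h p"
proof -
  obtain z w where zw: "z \<longlonglongrightarrow> p" "(\<lambda>r. h (z r)) \<longlonglongrightarrow> h p"
    "\<And>r. w r \<in> regular_subdifferential h (z r)" "(\<lambda>r. w r - v r) \<longlonglongrightarrow> 0"
    using regular_subgradient_diagonal[OF assms(1-4)] by blast
  from tendsto_add[OF zw(4) assms(5)] have "w \<longlonglongrightarrow> u" by simp
  with zw(1-3) assms(4) show ?thesis
    unfolding subdifferential_def by blast
qed

text \<open>The definition scales regular subgradients; limiting ones do as well, since
  \<open>t r *\<^sub>R (w r - v r)\<close> is a product of two null sequences.\<close>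

lemma horizon_subdifferential_limit:
  fixes h :: "'a::euclidean_space \<Rightarrow> ereal"
  assumes "\<And>r. v r \<in> subdifferential h (y r)" "y \<longlonglongrightarrow> p"
    "(\<lambda>r. h (y r)) \<longlonglongrightarrow> h p" "\<bar>h p\<bar> \<noteq> \<infinity>"
    "\<And>r. t r > 0" "t \<longlonglongrightarrow> 0" "(\<lambda>r. t r *\<^sub>R v r) \<longlonglongrightarrow> u"
  shows "u \<in> horizon_subdifferential h p"
proof -
  obtain z w where zw: "z \<longlonglongrightarrow> p" "(\<lambda>r. h (z r)) \<longlonglongrightarrow> h p"
    "\<And>r. w r \<in> regular_subdifferential h (z r)" "(\<lambda>r. w r - v r) \<longlonglongrightarrow> 0"
    using regular_subgradient_diagonal[OF assms(1-4)] by blast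
  from tendsto_add[OF tendsto_scaleR[OF assms(6) zw(4)] assms(7)]
  have "(\<lambda>r. t r *\<^sub>R w r) \<longlonglongrightarrow> u" by (simp add: algebra_simps)
  with zw(1-3) assms(4-6) show ?thesis
    unfolding horizon_subdifferential_def by blast
qed

lemma linear_grad_adjoint:
  assumes "continuously_differentiable c"
  shows "linear (grad_adjoint c p)"
proof -
  from assms obtain c' where "(c has_derivative blinfun_apply (c' p)) (at p)"
    by (auto simp: continuously_differentiable_def)
  then have "linear (frechet_derivative c (at p))"
    by (intro linear_frechet_derivative differentiableI)
  then show ?thesis
    unfolding grad_adjoint_def by (rule adjoint_linear)
qed

text \<open>Pairing with a basis vector moves the adjoint to the other side, leaving
  \<open>v r\<close> paired with the image of a fixed vector under \<open>c' (x r)\<close>. There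
  continuity of the derivative in operator norm applies.\<close>

lemma tendsto_grad_adjoint:
  assumes "continuously_differentiable c" "x \<longlonglongrightarrow> p" "v \<longlonglongrightarrow> u"
  shows "(\<lambda>r. grad_adjoint c (x r) (v r)) \<longlonglongrightarrow> grad_adjoint c p u"
proof -
  from assms(1) obtain c' where der: "\<And>x. (c has_derivative blinfun_apply (c' x)) (at x)"
    and cont: "continuous_on UNIV c'"
    by (auto simp: continuously_differentiable_def)
  have inner: "grad_adjoint c q w \<bullet> i = w \<bullet> blinfun_apply (c' q) i" for q w i
  proof -
    have "frechet_derivative c (at q) = blinfun_apply (c' q)"
      using frechet_derivative_at[OF der] by simp
    then show ?thesis
      by (simp add: grad_adjoint_def adjoint_clauses bounded_linear.linear blinfun.bounded_linear_right)
  qed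
  have c': "(\<lambda>r. c' (x r)) \<longlonglongrightarrow> c' p"
    using continuous_on_tendsto_compose[OF cont assms(2)] by simp
  have "(\<lambda>r. v r \<bullet> blinfun_apply (c' (x r)) i) \<longlonglongrightarrow> u \<bullet> blinfun_apply (c' p) i" for i
    by (intro tendsto_intros assms(3) c')
  then show ?thesis
    by (subst tendsto_componentwise_iff) (simp add: inner)
qed

lemma multiplier_subsequence:
  assumes cd: "continuously_differentiable c"
    and fin: "\<bar>h (c xbar)\<bar> \<noteq> \<infinity>"
    and cq: "horizon_subdifferential h (c xbar) \<inter> {w. grad_adjoint c xbar w = 0} = {0}"
    and sub: "\<And>r. v r \<in> subdifferential h (y r)"
    and x: "x \<longlonglongrightarrow> xbar"
    and y: "y \<longlonglongrightarrow> c xbar"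
    and hy: "(\<lambda>r. h (y r)) \<longlonglongrightarrow> h (c xbar)"
    and adj: "(\<lambda>r. grad_adjoint c (x r) (v r)) \<longlonglongrightarrow> 0"
  obtains s vbar where "strict_mono s" "(v \<circ> s) \<longlonglongrightarrow> vbar" "multiplier_vector h c xbar vbar"
proof -
  define t where "t r = 1 / (1 + norm (v r))" for r
  have pos: "1 + norm (v r) > 0" for r
    by (simp add: add_pos_nonneg)
  have t: "0 < t r" "t r \<le> 1" "norm (t r *\<^sub>R v r) = 1 - t r" for r
    using pos[of r] by (auto simp: t_def field_simps)
  \<comment> \<open>Both components have norm at most 1, whatever the size of \<open>v r\<close>, so
    Bolzano-Weierstrass applies.\<close>
  have "bounded (range (\<lambda>r. (t r, t r *\<^sub>R v r)))"
  proof (rule bounded_subset)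
    show "bounded (cball 0 1 \<times> cball 0 1)"
      by (intro bounded_Times bounded_cball)
    show "range (\<lambda>r. (t r, t r *\<^sub>R v r)) \<subseteq> cball 0 1 \<times> cball 0 1"
      using t by (auto simp: less_imp_le simp del: norm_scaleR)
  qed
  then obtain l s where s: "strict_mono s" and l: "((\<lambda>r. (t r, t r *\<^sub>R v r)) \<circ> s) \<longlonglongrightarrow> l"
    using bounded_imp_convergent_subsequence by blast
  obtain \<tau> w where "l = (\<tau>, w)" by (cases l)
  with tendsto_fst[OF l] tendsto_snd[OF l]
  have t_lim: "(\<lambda>r. t (s r)) \<longlonglongrightarrow> \<tau>" and tv_lim: "(\<lambda>r. t (s r) *\<^sub>R v (s r)) \<longlonglongrightarrow> w"
    by (auto simp: o_def)
  note sub_s = LIMSEQ_subseq_LIMSEQ[OF _ s, unfolded o_def]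
  have "\<tau> \<noteq> 0"
  proof
    assume \<tau>: "\<tau> = 0"
    \<comment> \<open>The identity \<open>norm (t r *\<^sub>R v r) = 1 - t r\<close> keeps the limit
      direction away from 0.\<close>
    from tendsto_norm[OF tv_lim] have "(\<lambda>r. 1 - t (s r)) \<longlonglongrightarrow> norm w"
      unfolding t(3) .
    moreover from tendsto_diff[OF tendsto_const t_lim, of 1] have "(\<lambda>r. 1 - t (s r)) \<longlonglongrightarrow> 1"
      by (simp add: \<tau>)
    ultimately have "norm w = 1"
      by (rule LIMSEQ_unique)
    have "w \<in> horizon_subdifferential h (c xbar)"
      by (rule horizon_subdifferential_limit[OF sub sub_s[OF y] sub_s[OF hy] fin t(1) _ tv_lim])
        (use t_lim \<tau> in simp)
    moreover have "grad_adjoint c xbar w = 0"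
    proof (rule LIMSEQ_unique)
      show "(\<lambda>r. grad_adjoint c (x (s r)) (t (s r) *\<^sub>R v (s r))) \<longlonglongrightarrow> grad_adjoint c xbar w"
        by (rule tendsto_grad_adjoint[OF cd sub_s[OF x] tv_lim])
      \<comment> \<open>By linearity the weight comes out as a factor: a convergent sequence times a
        null one.\<close>
      show "(\<lambda>r. grad_adjoint c (x (s r)) (t (s r) *\<^sub>R v (s r))) \<longlonglongrightarrow> 0"
        using tendsto_scaleR[OF t_lim sub_s[OF adj]]
        by (simp add: linear_cmul[OF linear_grad_adjoint[OF cd]])
    qed
    ultimately have "w = 0" using cq by blast
    with \<open>norm w = 1\<close> show False by simp
  qed
  then have "(\<lambda>r. inverse (t (s r)) *\<^sub>R (t (s r) *\<^sub>R v (s r))) \<longlonglongrightarrow> inverse \<tau> *\<^sub>R w"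
    by (intro tendsto_intros t_lim tv_lim)
  then have v_lim: "(\<lambda>r. v (s r)) \<longlonglongrightarrow> inverse \<tau> *\<^sub>R w"
    using t(1) by (simp add: less_imp_neq[THEN not_sym])
  have "inverse \<tau> *\<^sub>R w \<in> subdifferential h (c xbar)"
    by (rule subdifferential_closed[OF sub sub_s[OF y] sub_s[OF hy] fin v_lim])
  moreover have "grad_adjoint c xbar (inverse \<tau> *\<^sub>R w) = 0"
    by (rule LIMSEQ_unique[OF tendsto_grad_adjoint[OF cd sub_s[OF x] v_lim] sub_s[OF adj]])
  ultimately show thesis
    using that[OF s] v_lim by (simp add: multiplier_vector_def o_def)
qed

text \<open>The infimum may not be attained, so a point of \<open>A\<close> within
  \<open>e/2\<close> is taken instead. An empty \<open>A\<close> is excluded by the second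
  assumption, its distance being constantly infinite.\<close>

lemma dist_to_set_tendsto_0_imp_closure:
  assumes "p \<longlonglongrightarrow> l" "(\<lambda>r. dist_to_set (p r) A) \<longlonglongrightarrow> 0"
  shows "l \<in> closure A"
  unfolding closure_approachable
proof (intro allI impI)
  fix e :: real assume "e > 0"
  then have "\<forall>\<^sub>F r in sequentially. dist (p r) l < e/2"
    "\<forall>\<^sub>F r in sequentially. dist_to_set (p r) A < ereal (e/2)"
    using tendstoD[OF assms(1), of "e/2"] order_tendstoD(2)[OF assms(2), of "ereal (e/2)"]
    by auto
  then have "\<forall>\<^sub>F r in sequentially. dist (p r) l < e/2 \<and> dist_to_set (p r) A < ereal (e/2)"
    by (rule eventually_conj)
  then obtain r where "dist (p r) l < e/2" "dist_to_set (p r) A < ereal (e/2)"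
    using eventually_happens by force
  then obtain a where "a \<in> A" "dist (p r) a < e/2" "dist (p r) l < e/2"
    by (auto simp: dist_to_set_def INF_less_iff)
  then show "\<exists>a\<in>A. dist a l < e"
    using dist_triangle_half_r[of "p r" a e l] by blast
qed

theorem corollary2p5:
  fixes h :: "real ^ 'm \<Rightarrow> ereal"
    and c :: "real ^ 'n \<Rightarrow> real ^ 'm"
    and xbar :: "real ^ 'n"
    and \<G> :: "((real ^ 'm) \<times> (real ^ 'm)) set set"
    and x :: "nat \<Rightarrow> real ^ 'n"
    and y :: "nat \<Rightarrow> real ^ 'm"
    and v :: "nat \<Rightarrow> real ^ 'm"
    and G :: "nat \<Rightarrow> ((real ^ 'm) \<times> (real ^ 'm)) set"
  assumes "lower_semicontinuous h"
    and "continuously_differentiable c"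
    and "critical_point (h \<circ> c) xbar"
    and "horizon_subdifferential h (c xbar) \<inter> {w. grad_adjoint c xbar w = 0} = {0}"
    and "finite \<G>"
    and "\<And>A. A \<in> \<G> \<Longrightarrow> closedin (top_of_set (gph_subdifferential h)) A"
    and "\<And>r. v r \<in> subdifferential h (y r)"
    and "\<And>r. G r \<in> \<G>"
    and "x \<longlonglongrightarrow> xbar"
    and "(\<lambda>r. norm (y r - c (x r))) \<longlonglongrightarrow> 0"
    and "(\<lambda>r. h (y r)) \<longlonglongrightarrow> h (c xbar)"
    and "(\<lambda>r. grad_adjoint c (x r) (v r)) \<longlonglongrightarrow> 0"
    and "(\<lambda>r. dist_to_set (y r, v r) (G r)) \<longlonglongrightarrow> 0"
  shows "\<forall>\<^sub>F r in sequentially. actively_sufficient h c xbar (G r)"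
proof (rule ccontr)
  assume "\<not> ?thesis"
  \<comment> \<open>A property fails to hold eventually exactly when infinitely many indices violate
    it; the pigeonhole principle then fixes one set \<open>G r0\<close>.\<close>
  then have inf: "infinite {r. \<not> actively_sufficient h c xbar (G r)}"
    by (simp add: cofinite_eq_sequentially[symmetric] eventually_cofinite)
  have "finite (G ` {r. \<not> actively_sufficient h c xbar (G r)})"
    by (rule finite_subset[OF _ assms(5)]) (use assms(8) in auto)
  from pigeonhole_infinite[OF inf this] obtain r0 where r0: "\<not> actively_sufficient h c xbar (G r0)"
    and inf0: "infinite {r. \<not> actively_sufficient h c xbar (G r) \<and> G r = G r0}"
    by auto
  define s where "s = enumerate {r. \<not> actively_sufficient h c xbar (G r) \<and> G r = G r0}"
  have s: "strict_mono s"
    unfolding s_def by (rule strict_mono_enumerate[OF inf0])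
  have Gs: "G (s r) = G r0" for r
    using enumerate_in_set[OF inf0, of r] by (simp add: s_def)
  note sub_s = LIMSEQ_subseq_LIMSEQ[OF _ s, unfolded o_def]
  from assms(2) have "isCont c xbar"
    by (auto simp: continuously_differentiable_def intro: has_derivative_continuous)
  then have "(\<lambda>r. c (x r)) \<longlonglongrightarrow> c xbar"
    using assms(9) by (rule isCont_tendsto_compose)
  from tendsto_add[OF tendsto_norm_zero_cancel[OF assms(10)] this] have y: "y \<longlonglongrightarrow> c xbar"
    by simp
  \<comment> \<open>Criticality gives a subgradient of \<open>h \<circ> c\<close> at
    \<open>xbar\<close>, and these exist only at finite values.\<close>
  have fin: "\<bar>h (c xbar)\<bar> \<noteq> \<infinity>"
    using assms(3) by (simp add: critical_point_def subdifferential_def)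
  obtain t vbar where t: "strict_mono t" and v: "((\<lambda>r. v (s r)) \<circ> t) \<longlonglongrightarrow> vbar"
    and mult: "multiplier_vector h c xbar vbar"
    by (rule multiplier_subsequence[where h = h, OF assms(2) fin assms(4) assms(7) sub_s[OF assms(9)]
          sub_s[OF y] sub_s[OF assms(11)] sub_s[OF assms(12)]])
  note sub_st = LIMSEQ_subseq_LIMSEQ[OF sub_s t, unfolded o_def]
  have "(\<lambda>r. (y (s (t r)), v (s (t r)))) \<longlonglongrightarrow> (c xbar, vbar)"
    using sub_st[OF y] v by (intro tendsto_Pair) (auto simp: o_def)
  moreover have "(\<lambda>r. dist_to_set (y (s (t r)), v (s (t r))) (G r0)) \<longlonglongrightarrow> 0"
    using sub_st[OF assms(13)] by (simp add: Gs)
  ultimately have cl: "(c xbar, vbar) \<in> closure (G r0)"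
    by (rule dist_to_set_tendsto_0_imp_closure)
  \<comment> \<open>Closedness is relative to the graph, so membership of the limit pair has two
    halves: the closed set \<open>T\<close> contains it as a limit, and the graph contains it
    because \<open>vbar\<close> is a subgradient.\<close>
  from assms(6)[OF assms(8)] obtain T where T: "closed T" "G r0 = gph_subdifferential h \<inter> T"
    by (auto simp: closedin_closed)
  then have "(c xbar, vbar) \<in> T"
    using cl closure_minimal[of "G r0" T] by blast
  moreover have "(c xbar, vbar) \<in> gph_subdifferential h"
    using mult by (simp add: gph_subdifferential_def multiplier_vector_def)
  ultimately have "actively_sufficient h c xbar (G r0)"
    using T(2) mult by (auto simp: actively_sufficient_def)
  with r0 show False ..
qed

end
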